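(* Let $k$ be such that $2k$ is a positive integer, and let $n\ge 0$. (1) For every $k$-Eulerian poset $P$ of rank $n+1$, every subset $S\subseteq[1,n]$, and every maximal interval $[i,\ell]$ (set of consecutive integers, maximal under inclusion) of $[1,n]\setminus S$, $$k\bigl((-1)^{i-1}+(-1)^{\ell+1}\bigr)f_S(P)+\sum_{j=i}^{\ell}(-1)^j f_{S\cup\{j\}}(P)=0.$$ (2) Every linear equality $\sum_{S\subseteq[1,n]}c_Sf_S(P)=0$ holding for the flag vectors of all $k$-Eulerian posets $P$ of rank $n+1$ is a linear consequence of the equations in (1). (3) As linear conditions on $(f_S)_{S\subseteq[1,n]}$, the equations in (1) are equivalent to the set of equations $L^{k,n+1}_S=0$ for all subsets $S\subseteq[1,n]$ that are not even.
   Context: A graded poset is a finite poset with unique minimum $\hat 0$, unique maximum $\hat 1$, and a rank function $\rho$ with $\rho(\hat0)=0$ and $\rho(y)-\rho(x)=1$ when $y$ covers $x$; its rank is $\rho(\hat1)$, $\rho(x,y)=\rho(y)-\rho(x)$. For $P$ of rank $n+1$ and $S\subseteq[1,n]$, $f_S(P)$ is the number of chains in $P$ whose set of ranks is exactly $S$ ($f_\emptyset=1$). The $k$-Möbius function: $\mu_k([x,x])=1$ and, for $x<y$, $\mu_k([x,y])=-1-\frac1k\sum_{x<z<y}\mu_k([x,z])$; $P$ is $k$-Eulerian if $\mu_k([x,y])=(-1)^{\rho(x,y)}$ for all intervals. The flag $L^k$-vector is $L^{k,n+1}_S=(-1)^{n-|S|}\sum_{T\supseteq[1,n]\setminus S}\left(-\frac1{2k}\right)^{|T|}f_T$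 for $S\subseteq[1,n]$ (sum over $T\subseteq[1,n]$). A set $S\subseteq[1,n]$ is even if it is a disjoint union of intervals of consecutive integers each of even cardinality (equivalently, each maximal run of consecutive integers in $S$ has even length). *)

theory Defs
  imports Complex_Main "HOL-Library.Disjoint_Sets"
begin

text \<open>A finite poset is given by its reflexive order relation \<open>r\<close>; its set of elements is
  \<open>Field r\<close>.\<close>

definition covers :: "'a rel \<Rightarrow> 'a \<Rightarrow> 'a \<Rightarrow> bool" where
  "covers r y x \<longleftrightarrow> (x, y) \<in> r \<and> x \<noteq> y \<and>
     \<not> (\<exists>z. (x, z) \<in> r \<and> z \<noteq> x \<and> (z, y) \<in> r \<and> z \<noteq> y)"

definition graded_poset :: "'a rel \<Rightarrow> ('a \<Rightarrow> nat) \<Rightarrow> nat \<Rightarrow> bool" where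
  "graded_poset r \<rho> m \<longleftrightarrow>
     finite (Field r) \<and> Partial_order r \<and>
     (\<exists>bot\<in>Field r. (\<forall>x\<in>Field r. (bot, x) \<in> r) \<and> \<rho> bot = 0) \<and>
     (\<exists>top\<in>Field r. (\<forall>x\<in>Field r. (x, top) \<in> r) \<and> \<rho> top = m) \<and>
     (\<forall>x y. covers r y x \<longrightarrow> \<rho> y = \<rho> x + 1)"

text \<open>Only \<open>S \<subseteq> {1..n}\<close> matters, for a poset of rank \<open>n + 1\<close>. A member of \<open>Chains r\<close> may be
  empty, and is a subset of \<open>Field r\<close>.\<close>

definition flag_f :: "'a rel \<Rightarrow> ('a \<Rightarrow> nat) \<Rightarrow> nat set \<Rightarrow> nat" where
  "flag_f r \<rho> S = card {C \<in> Chains r. \<rho> ` C = S}"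

text \<open>The guard on \<open>r\<close> only makes the recursion terminate; \<open>k_moebius k r x y\<close> is meaningful for
  \<open>(x, y) \<in> r\<close>.\<close>

function k_moebius :: "real \<Rightarrow> 'a rel \<Rightarrow> 'a \<Rightarrow> 'a \<Rightarrow> real" where
  "k_moebius k r x y =
     (if x = y then 1
      else if finite (Field r) \<and> Partial_order r then
        - 1 - 1 / k * (\<Sum>z | (x, z) \<in> r \<and> z \<noteq> x \<and> (z, y) \<in> r \<and> z \<noteq> y. k_moebius k r x z)
      else 0)"
  by pat_completeness auto

termination
proof (relation "measure (\<lambda>(k, r, x, y). card {w. (x, w) \<in> r \<and> (w, y) \<in> r \<and> w \<noteq> y})",
    goal_cases)
  case 1
  show ?case by simp
next
  case (2 k r x y z)
  then have fin: "finite (Field r)" and tr: "trans r" and an: "antisym r"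
    and z: "(x, z) \<in> r" "(z, y) \<in> r" "z \<noteq> y"
    by (auto simp: partial_order_on_def preorder_on_def)
  have "finite {w. (x, w) \<in> r \<and> (w, y) \<in> r \<and> w \<noteq> y}"
    by (rule finite_subset[OF _ fin]) (auto simp: Field_def)
  moreover have "{w. (x, w) \<in> r \<and> (w, z) \<in> r \<and> w \<noteq> z} \<subset> {w. (x, w) \<in> r \<and> (w, y) \<in> r \<and> w \<noteq> y}"
    using z transD[OF tr] antisymD[OF an] by blast
  ultimately show ?case by (simp add: psubset_card_mono)
qed

declare k_moebius.simps [simp del]

definition k_eulerian :: "real \<Rightarrow> 'a rel \<Rightarrow> ('a \<Rightarrow> nat) \<Rightarrow> nat \<Rightarrow> bool" where
  "k_eulerian k r \<rho> m \<longleftrightarrow> graded_poset r \<rho> m \<and>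
     (\<forall>x y. (x, y) \<in> r \<longrightarrow> k_moebius k r x y = (- 1) ^ (\<rho> y - \<rho> x))"

definition flag_L :: "real \<Rightarrow> nat \<Rightarrow> (nat set \<Rightarrow> real) \<Rightarrow> nat set \<Rightarrow> real" where
  "flag_L k n f S = (- 1) ^ (n - card S) *
     (\<Sum>T | {1..n} - S \<subseteq> T \<and> T \<subseteq> {1..n}. (- (1 / (2 * k))) ^ card T * f T)"

definition even_set :: "nat set \<Rightarrow> bool" where
  "even_set S \<longleftrightarrow> (\<exists>Q. partition_on S Q \<and> (\<forall>I\<in>Q. \<exists>a b. I = {a..b} \<and> even (card I)))"

text \<open>The maximal intervals considered are nonempty.\<close>

definition maximal_interval :: "nat set \<Rightarrow> nat \<Rightarrow> nat \<Rightarrow> bool" where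
  "maximal_interval U i l \<longleftrightarrow> i \<le> l \<and> {i..l} \<subseteq> U \<and>
     (\<forall>i' l'. {i..l} \<subseteq> {i'..l'} \<and> {i'..l'} \<subseteq> U \<longrightarrow> {i'..l'} = {i..l})"

definition relation_index :: "nat \<Rightarrow> (nat set \<times> nat \<times> nat) set" where
  "relation_index n = {(S, i, l). S \<subseteq> {1..n} \<and> maximal_interval ({1..n} - S) i l}"

definition relation_form :: "real \<Rightarrow> (nat set \<Rightarrow> real) \<Rightarrow> nat set \<times> nat \<times> nat \<Rightarrow> real" where
  "relation_form k f = (\<lambda>(S, i, l).
     k * ((- 1) ^ (i - 1) + (- 1) ^ (l + 1)) * f S + (\<Sum>j = i..l. (- 1) ^ j * f (S \<union> {j})))"

end

theory Submission
  imports Defs "HOL-Library.Nat_Bijection"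
begin

text \<open>Moebius inversion turns the definition of the flag \<open>L\<close>-vector into
  \<open>f\<^sub>U = (2k)\<^bsup>|U|\<^esup> \<Sum>L\<^sub>R\<close>, summed over the sets \<open>R\<close> of ranks disjoint from \<open>U\<close>. In these coordinates
  the relation indexed by \<open>(S, i, l)\<close> says that \<open>\<Sum>L\<^sub>R w(R \<inter> [i, l]) = 0\<close>, summed over
  \<open>R\<close> disjoint from \<open>S\<close>, where \<open>w(A)\<close> is the sum of \<open>(-1)\<^bsup>j\<^esup>\<close> over \<open>j \<in> A\<close>. The weight vanishes when
  \<open>R\<close> is even, so by induction on \<open>R\<close> the relations span exactly the \<open>L\<^sub>R\<close> with \<open>R\<close> not even.
  They hold in a \<open>k\<close>-Eulerian poset by summing the \<open>k\<close>-Moebius recursion over the chains with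
  rank set \<open>S\<close>, and they are complete because every even set \<open>R\<close> is the
  largest member of the support of the \<open>L\<close>-vector of some \<open>k\<close>-Eulerian poset, obtained from a chain by duplication.\<close>

subsection \<open>Alternating sums over intervals\<close>

lemma sum_alternating:
  "(\<Sum>j\<in>{a..<a + d}. (- 1) ^ j) = (if even d then 0 else (- 1) ^ a :: real)"
  by (induction d) (auto simp: power_add)

text \<open>Inner terms cancel in pairs, and one sign is left over exactly when \<open>a\<close> and
  \<open>b\<close> have equal parity. With \<open>a = i - 1\<close> and \<open>b = l + 1\<close>
  this explains the coefficient of \<open>f S\<close> in \<open>relation_form\<close>: it is
  \<open>- 2 * k\<close> times the alternating sum over \<open>{i..l}\<close>.\<close>

lemma sum_alternating_greaterThanLessThan:
  assumes "a < b"
  shows "(\<Sum>j\<in>{a<..<b}. (- 1) ^ j) = - ((- 1) ^ a + (- 1) ^ b) / (2 :: real)"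
proof -
  obtain d where d: "b = Suc a + d"
    using assms less_iff_Suc_add by auto
  have "{a<..<b} = {Suc a..<Suc a + d}"
    unfolding d by auto
  then show ?thesis
    using sum_alternating[of "Suc a" d] by (simp add: d power_add)
qed

lemma sum_alternating_atLeastAtMost:
  assumes "a \<le> b"
  shows "(\<Sum>j=a..b. (- 1) ^ j) = (if even (card {a..b}) then 0 else (- 1) ^ a :: real)"
proof -
  have "{a..b} = {a..<a + card {a..b}}"
    using assms by auto
  then show ?thesis
    using sum_alternating[of a "card {a..b}"] by metis
qed

text \<open>Naming the partition behind \<open>even_set\<close> keeps its blocks available: they are
  later restricted to subfamilies and doubled in a poset.\<close>

definition even_interval_partition :: "nat set \<Rightarrow> nat set set \<Rightarrow> bool" where
  "even_interval_partition S Q \<longleftrightarrow>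
     partition_on S Q \<and> (\<forall>I\<in>Q. \<exists>a b. I = {a..b} \<and> even (card I))"

lemma even_set_iff: "even_set S \<longleftrightarrow> (\<exists>Q. even_interval_partition S Q)"
  by (simp add: even_set_def even_interval_partition_def)

lemma even_interval_partition_subset:
  assumes "even_interval_partition S Q" "A \<subseteq> Q"
  shows "even_interval_partition (\<Union>A) A"
proof -
  have "disjoint A" "{} \<notin> A"
    using assms partition_onD2[of S Q] partition_onD3[of S Q] pairwise_subset[of _ Q A]
    unfolding even_interval_partition_def by auto
  then show ?thesis
    using assms by (auto simp: even_interval_partition_def partition_on_def)
qed

text \<open>Since \<open>A\<close> cuts no block, \<open>S \<inter> A\<close> is a union of whole
  blocks, and each even block has alternating sum zero.\<close>

lemma sum_alternating_blocks:
  assumes Q: "even_interval_partition S Q"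
    and A: "\<And>I. I \<in> Q \<Longrightarrow> I \<subseteq> A \<or> I \<inter> A = {}"
  shows "(\<Sum>j\<in>S \<inter> A. (- 1) ^ j) = (0 :: real)"
proof -
  define P where "P = {I \<in> Q. I \<subseteq> A}"
  have part: "partition_on S Q"
    using Q by (simp add: even_interval_partition_def)
  have disj: "\<forall>I\<in>P. \<forall>J\<in>P. I \<noteq> J \<longrightarrow> I \<inter> J = {}"
    using partition_onD2[OF part] unfolding P_def disjoint_def by blast
  have block: "finite I \<and> (\<Sum>j\<in>I. (- 1) ^ j) = (0 :: real)" if "I \<in> P" for I
  proof -
    have I: "I \<in> Q"
      using that by (simp add: P_def)
    then obtain a b where ab: "I = {a..b}" "even (card I)"
      using Q unfolding even_interval_partition_def by blast
    have "a \<le> b"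
      using I ab partition_onD3[OF part] by auto
    then show ?thesis
      using ab sum_alternating_atLeastAtMost[of a b] by simp
  qed
  have "S \<inter> A = \<Union>P"
    using partition_onD1[OF part] A unfolding P_def by blast
  moreover have "sum (\<lambda>j. (- 1 :: real) ^ j) (\<Union>P) = (sum \<circ> sum) (\<lambda>j. (- 1) ^ j) P"
    by (intro sum.Union_disjoint ballI disj) (use block in blast)
  ultimately have "(\<Sum>j\<in>S \<inter> A. (- 1) ^ j) = (\<Sum>I\<in>P. \<Sum>j\<in>I. (- 1 :: real) ^ j)"
    unfolding o_def by (simp only:)
  also have "\<dots> = 0"
    using block by simp
  finally show ?thesis .
qed

subsection \<open>Maximal intervals\<close>

text \<open>Maximality forbids adding \<open>i - 1\<close> or \<open>l + 1\<close>, so each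
  neighbour is in \<open>S\<close> or outside \<open>{1..n}\<close>. In a poset the outer neighbours
  0 and \<open>n + 1\<close> are the ranks of bottom and top.\<close>

lemma maximal_interval_cases:
  assumes "maximal_interval ({1..n} - S) i l"
  shows "1 \<le> i" "i \<le> l" "l \<le> n" "{i..l} \<inter> S = {}" "i = 1 \<or> i - 1 \<in> S" "l = n \<or> l + 1 \<in> S"
proof -
  have il: "i \<le> l" and sub: "{i..l} \<subseteq> {1..n} - S"
    and max: "\<And>i' l'. {i..l} \<subseteq> {i'..l'} \<Longrightarrow> {i'..l'} \<subseteq> {1..n} - S \<Longrightarrow> {i'..l'} = {i..l}"
    using assms unfolding maximal_interval_def by auto
  have i: "i \<in> {1..n} - S" and l: "l \<in> {1..n} - S"
    using il sub by auto
  then show "1 \<le> i" "l \<le> n"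
    by auto
  show "i \<le> l" "{i..l} \<inter> S = {}"
    using il sub by auto
  show "i = 1 \<or> i - 1 \<in> S"
  proof (rule ccontr)
    assume *: "\<not> (i = 1 \<or> i - 1 \<in> S)"
    have "{i - 1..l} = insert (i - 1) {i..l}"
      using i il by auto
    then have "{i - 1..l} = {i..l}"
      using * i sub by (intro max) auto
    then show False
      using i il by (auto simp: Icc_eq_Icc)
  qed
  show "l = n \<or> l + 1 \<in> S"
  proof (rule ccontr)
    assume *: "\<not> (l = n \<or> l + 1 \<in> S)"
    have "{i..l + 1} = insert (l + 1) {i..l}"
      using il by auto
    then have "{i..l + 1} = {i..l}"
      using * l sub by (intro max) auto
    then show False
      using il by (auto simp: Icc_eq_Icc)
  qed
qed

text \<open>Two intervals that meet have an interval as their union, and maximality leaves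
  \<open>{i..l}\<close> no room to grow.\<close>

lemma maximal_interval_absorbs:
  assumes "maximal_interval U i l" "{a..b} \<subseteq> U"
  shows "{a..b} \<subseteq> {i..l} \<or> {a..b} \<inter> {i..l} = {}"
proof (rule ccontr)
  assume *: "\<not> ?thesis"
  then have "{min a i..max b l} = {a..b} \<union> {i..l}"
    by auto
  then have "{min a i..max b l} = {i..l}"
    using assms unfolding maximal_interval_def by blast
  then show False
    using * \<open>{min a i..max b l} = {a..b} \<union> {i..l}\<close> by auto
qed

text \<open>Maximality only has to be tested among intervals through \<open>x\<close>, because any
  interval containing \<open>{i..l}\<close> also contains \<open>x\<close>.\<close>

lemma maximal_interval_exists:
  assumes "finite U" "x \<in> U"
  obtains i l where "maximal_interval U i l" "x \<in> {i..l}"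
proof -
  define W where "W = {{i..l} | i l. x \<in> {i..l} \<and> {i..l} \<subseteq> U}"
  have "finite W"
    by (rule finite_subset[of _ "Pow U"]) (auto simp: W_def assms)
  moreover have "{x..x} \<in> W"
    unfolding W_def using assms(2) by fastforce
  ultimately obtain M where M: "M \<in> W" "\<And>J. J \<in> W \<Longrightarrow> M \<subseteq> J \<Longrightarrow> J = M"
    using finite_has_maximal[of W] by blast
  then obtain i l where il: "M = {i..l}" "x \<in> {i..l}" "{i..l} \<subseteq> U"
    unfolding W_def by blast
  have "maximal_interval U i l"
    unfolding maximal_interval_def
  proof (intro conjI allI impI)
    fix i' l' assume *: "{i..l} \<subseteq> {i'..l'} \<and> {i'..l'} \<subseteq> U"
    then have "{i'..l'} \<in> W"
      unfolding W_def using il by blast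
    then show "{i'..l'} = {i..l}"
      using M(2) il * by blast
  qed (use il in auto)
  then show ?thesis
    using that il by blast
qed

text \<open>By absorption, distinct maximal runs are disjoint, so they partition \<open>S\<close>;
  if all had even length, they would witness \<open>even_set S\<close>.\<close>

lemma odd_maximal_interval:
  assumes fin: "finite S" and "\<not> even_set S"
  obtains i l where "maximal_interval S i l" "odd (card {i..l})"
proof -
  define Q where "Q = {{i..l} | i l. maximal_interval S i l}"
  have "\<Union>Q = S"
  proof
    show "\<Union>Q \<subseteq> S"
      unfolding Q_def maximal_interval_def by blast
    show "S \<subseteq> \<Union>Q"
    proof
      fix x assume "x \<in> S"
      then obtain i l where "maximal_interval S i l" "x \<in> {i..l}"
        by (rule maximal_interval_exists[OF fin])
      then show "x \<in> \<Union>Q"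
        unfolding Q_def by blast
    qed
  qed
  moreover have "I = J" if "I \<in> Q" "J \<in> Q" "I \<inter> J \<noteq> {}" for I J
  proof -
    from that(1,2) obtain a b i l where
      ab: "I = {a..b}" "maximal_interval S a b" and il: "J = {i..l}" "maximal_interval S i l"
      unfolding Q_def by blast
    have "{a..b} \<subseteq> S" "{i..l} \<subseteq> S"
      using ab il unfolding maximal_interval_def by blast+
    then show ?thesis
      using maximal_interval_absorbs[OF ab(2), of i l] maximal_interval_absorbs[OF il(2), of a b]
        that(3) ab il by blast
  qed
  moreover have "{} \<notin> Q"
    unfolding Q_def maximal_interval_def by auto
  ultimately have "partition_on S Q"
    unfolding partition_on_def disjoint_def by blast
  then have "\<not> (\<forall>I\<in>Q. \<exists>a b. I = {a..b} \<and> even (card I))"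
    using assms(2) unfolding even_set_def by blast
  then show ?thesis
    using that unfolding Q_def by blast
qed

subsection \<open>The flag \<open>L\<close>-vector as a change of coordinates\<close>

text \<open>Passing to complements turns the sum over supersets of \<open>{1..n} - R\<close> into a
  signed sum over subsets of \<open>R\<close>, and that transform is its own inverse.\<close>

lemma flag_L_inversion:
  assumes k: "k \<noteq> 0" and U: "U \<subseteq> {1..n}"
  shows "f U = (2 * k) ^ card U * (\<Sum>R\<in>Pow ({1..n} - U). flag_L k n f R)"
proof -
  define N where "N = {1..n}"
  \<comment> \<open>\<open>F\<close> absorbs one factor \<open>1 / (2 * k)\<close> per rank.
    \<open>G\<close> is its signed subset transform and agrees with \<open>flag_L\<close> up to the
    sign \<open>(- 1) ^ card R\<close>.\<close>
  define F where "F W = f (N - W) / (2 * k) ^ card (N - W)" for W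
  define G where "G S = (\<Sum>W\<in>Pow S. (- 1) ^ card W * F W)" for S
  have finN: "finite N"
    by (simp add: N_def)
  have L: "flag_L k n f R = (- 1) ^ card R * G R" if R: "R \<subseteq> N" for R
  proof -
    have "(\<Sum>T | N - R \<subseteq> T \<and> T \<subseteq> N. (- (1 / (2 * k))) ^ card T * f T)
        = (\<Sum>W\<in>Pow R. (- 1) ^ n * ((- 1) ^ card W * F W))"
    proof (rule sum.reindex_bij_witness[where i = "\<lambda>W. N - W" and j = "\<lambda>T. N - T"])
      fix T assume T: "T \<in> {T. N - R \<subseteq> T \<and> T \<subseteq> N}"
      then have "card (N - T) = n - card T" "card T \<le> n"
        using finN card_mono[of N T] by (auto simp: card_Diff_subset finite_subset N_def)
      then have "(- 1 :: real) ^ n * (- 1) ^ card (N - T) = (- 1) ^ card T"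
        by (simp flip: power_add add: minus_one_power_iff)
      moreover have "N - (N - T) = T"
        using T by auto
      ultimately have "(- 1) ^ n * ((- 1) ^ card (N - T) * F (N - T))
          = (- 1) ^ card T * (f T / (2 * k) ^ card T)"
        by (simp add: F_def flip: mult.assoc)
      also have "\<dots> = (- (1 / (2 * k))) ^ card T * f T"
        by (subst power_minus) (simp add: power_divide)
      finally show "(- 1) ^ n * ((- 1) ^ card (N - T) * F (N - T))
          = (- (1 / (2 * k))) ^ card T * f T" .
    qed (use R in auto)
    then have "flag_L k n f R = (- 1) ^ (n - card R) * (- 1) ^ n * G R"
      unfolding flag_L_def N_def[symmetric] G_def by (simp add: sum_distrib_left mult.assoc)
    moreover have "card R \<le> n"
      using card_mono[OF finN R] by (simp add: N_def)
    then have "(- 1 :: real) ^ (n - card R) * (- 1) ^ n = (- 1) ^ card R"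
      by (simp flip: power_add add: minus_one_power_iff)
    ultimately show ?thesis
      by simp
  qed
  have "F (N - U) = (\<Sum>R\<in>Pow (N - U). (- 1) ^ card R * G R)"
    by (rule inclusion_exclusion_symmetric) (auto simp: G_def finN)
  also have "\<dots> = (\<Sum>R\<in>Pow (N - U). flag_L k n f R)"
    by (rule sum.cong) (auto intro!: L[symmetric])
  also have "F (N - U) = f U / (2 * k) ^ card U"
    using U by (simp add: F_def N_def double_diff)
  finally show ?thesis
    using k by (simp add: N_def field_simps)
qed

text \<open>Exchanging the sums over disjoint pairs \<open>(U, R)\<close> exhibits the coefficients
  of a linear form in the \<open>L\<close>-coordinates. At even \<open>R\<close> these are the
  numbers that the test posets force to vanish.\<close>

lemma linear_form_flag_L:
  assumes "k \<noteq> 0"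
  shows "(\<Sum>U\<in>Pow {1..n}. c U * f U)
    = (\<Sum>R\<in>Pow {1..n}. (\<Sum>U\<in>Pow ({1..n} - R). c U * (2 * k) ^ card U) * flag_L k n f R)"
proof -
  have "(\<Sum>U\<in>Pow {1..n}. c U * f U)
      = (\<Sum>U\<in>Pow {1..n}. \<Sum>R\<in>Pow ({1..n} - U). c U * (2 * k) ^ card U * flag_L k n f R)"
    using flag_L_inversion[OF assms, of _ n f]
    by (intro sum.cong refl) (simp add: sum_distrib_left mult.assoc)
  also have "\<dots> = (\<Sum>R\<in>Pow {1..n}. \<Sum>U\<in>Pow ({1..n} - R). c U * (2 * k) ^ card U * flag_L k n f R)"
    by (subst sum.Sigma, simp, simp, subst sum.Sigma, simp, simp)
      (rule sum.reindex_bij_witness[where i = prod.swap and j = prod.swap], auto)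
  finally show ?thesis
    by (simp add: sum_distrib_right)
qed

text \<open>After inversion, \<open>f (S \<union> {j})\<close> differs from \<open>f S\<close> by
  omitting those \<open>R\<close> that contain \<open>j\<close>, apart from a factor
  \<open>2 * k\<close>. The term in \<open>f S\<close> cancels the full alternating sum over
  \<open>{i..l}\<close>, so only the ranks \<open>j\<close> in \<open>R\<close> survive, with
  opposite sign.\<close>

lemma relation_form_flag_L:
  assumes k: "k \<noteq> 0" and idx: "(S, i, l) \<in> relation_index n"
  shows "relation_form k f (S, i, l) = - ((2 * k) ^ (card S + 1)) *
    (\<Sum>R\<in>Pow ({1..n} - S). flag_L k n f R * (\<Sum>j\<in>R \<inter> {i..l}. (- 1) ^ j))"
proof -
  have S: "S \<subseteq> {1..n}" and max: "maximal_interval ({1..n} - S) i l"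
    using idx by (auto simp: relation_index_def)
  note il = maximal_interval_cases[OF max]
  have finS: "finite S"
    using S finite_subset by blast
  define P where "P = Pow ({1..n} - S)"
  define L where "L = flag_L k n f"
  define c where "c = (2 * k) ^ (card S + 1)"
  have "{i - 1<..<l + 1} = {i..l}"
    using il(1) by auto
  then have w: "(\<Sum>j=i..l. (- 1) ^ j) = - ((- 1) ^ (i - 1) + (- 1) ^ (l + 1)) / (2 :: real)"
    using sum_alternating_greaterThanLessThan[of "i - 1" "l + 1"] il(1,2) by simp
  \<comment> \<open>The extra factor \<open>k\<close> lets \<open>f S\<close> share the constant
    \<open>c\<close> with all \<open>f (S \<union> {j})\<close>, whose index sets have
    \<open>card S + 1\<close> elements.\<close>
  have fS: "k * f S = c / 2 * (\<Sum>R\<in>P. L R)"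
    using flag_L_inversion[OF k S, of f] by (simp add: c_def P_def L_def)
  have fj: "f (S \<union> {j}) = c * (\<Sum>R\<in>P. if j \<in> R then 0 else L R)" if "j \<in> {i..l}" for j
  proof -
    have j: "j \<notin> S" "S \<union> {j} \<subseteq> {1..n}"
      using that il S by auto
    have "Pow ({1..n} - (S \<union> {j})) = {R \<in> P. j \<notin> R}"
      by (auto simp: P_def)
    then have "(\<Sum>R\<in>Pow ({1..n} - (S \<union> {j})). L R) = (\<Sum>R\<in>P. if j \<in> R then 0 else L R)"
      by (intro sum.mono_neutral_cong_left) (auto simp: P_def)
    then show ?thesis
      using flag_L_inversion[OF k j(2), of f] j(1) finS by (simp add: c_def L_def)
  qed
  have "(\<Sum>j=i..l. (- 1) ^ j * f (S \<union> {j}))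
      = (\<Sum>j=i..l. \<Sum>R\<in>P. c * (if j \<in> R then 0 else (- 1) ^ j * L R))"
    using fj by (intro sum.cong refl) (simp add: sum_distrib_left if_distrib mult_ac cong: if_cong)
  also have "\<dots> = (\<Sum>R\<in>P. \<Sum>j=i..l. c * (if j \<in> R then 0 else (- 1) ^ j * L R))"
    by (rule sum.swap)
  also have "\<dots> = (\<Sum>R\<in>P. c * L R * ((\<Sum>j=i..l. (- 1) ^ j) - (\<Sum>j\<in>R \<inter> {i..l}. (- 1) ^ j)))"
  proof (rule sum.cong[OF refl])
    fix R
    have "(\<Sum>j=i..l. c * (if j \<in> R then 0 else (- 1) ^ j * L R))
        = (\<Sum>j\<in>{i..l} - R. c * L R * (- 1) ^ j)"
      by (rule sum.mono_neutral_cong_right) auto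
    also have "\<dots> = c * L R * (\<Sum>j\<in>{i..l} - (R \<inter> {i..l}). (- 1) ^ j)"
      by (simp add: sum_distrib_left Diff_Int)
    also have "\<dots> = c * L R * ((\<Sum>j=i..l. (- 1) ^ j) - (\<Sum>j\<in>R \<inter> {i..l}. (- 1) ^ j))"
      by (subst sum_diff) auto
    finally show "(\<Sum>j=i..l. c * (if j \<in> R then 0 else (- 1) ^ j * L R))
        = c * L R * ((\<Sum>j=i..l. (- 1) ^ j) - (\<Sum>j\<in>R \<inter> {i..l}. (- 1) ^ j))" .
  qed
  finally have sumj: "(\<Sum>j=i..l. (- 1) ^ j * f (S \<union> {j}))
      = (\<Sum>R\<in>P. c * L R * ((\<Sum>j=i..l. (- 1) ^ j) - (\<Sum>j\<in>R \<inter> {i..l}. (- 1) ^ j)))" .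
  have "k * ((- 1) ^ (i - 1) + (- 1) ^ (l + 1)) * f S = - c * (\<Sum>j=i..l. (- 1) ^ j) * (\<Sum>R\<in>P. L R)"
  proof -
    have "k * ((- 1) ^ (i - 1) + (- 1) ^ (l + 1)) * f S
        = ((- 1) ^ (i - 1) + (- 1) ^ (l + 1)) * (k * f S)"
      by simp
    then show ?thesis
      unfolding fS w by (simp add: algebra_simps)
  qed
  moreover have "(\<Sum>R\<in>P. c * L R * (a - w R)) = c * a * (\<Sum>R\<in>P. L R) - c * (\<Sum>R\<in>P. L R * w R)"
    for a :: real and w
    by (simp add: right_diff_distrib sum_subtractf sum_distrib_left mult_ac)
  ultimately have "relation_form k f (S, i, l) = - c * (\<Sum>R\<in>P. L R * (\<Sum>j\<in>R \<inter> {i..l}. (- 1) ^ j))"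
    unfolding relation_form_def split sumj by (simp only:)
  then show ?thesis
    by (simp add: c_def P_def L_def)
qed

text \<open>Every block of \<open>R\<close> is an interval inside \<open>U\<close>, so it is
  absorbed by \<open>{i..l}\<close> or misses it.\<close>

lemma sum_alternating_even_set:
  assumes "even_set R" "R \<subseteq> U" "maximal_interval U i l"
  shows "(\<Sum>j\<in>R \<inter> {i..l}. (- 1) ^ j) = (0 :: real)"
proof -
  obtain Q where Q: "even_interval_partition R Q"
    using assms(1) by (auto simp: even_set_iff)
  show ?thesis
  proof (rule sum_alternating_blocks[OF Q])
    fix I assume "I \<in> Q"
    then obtain a b where "I = {a..b}" "I \<subseteq> R"
      using Q unfolding even_interval_partition_def partition_on_def by blast
    then show "I \<subseteq> {i..l} \<or> I \<inter> {i..l} = {}"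
      using maximal_interval_absorbs[OF assms(3), of a b] assms(2) by blast
  qed
qed

text \<open>Each summand vanishes for one of two reasons: the \<open>L\<close>-value is zero when
  \<open>R\<close> is not even, and the weight is zero when \<open>R\<close> is even. This is one
  direction of (3).\<close>

lemma relation_form_eq_0:
  assumes k: "k \<noteq> 0" and "t \<in> relation_index n"
    and L: "\<And>R. R \<subseteq> {1..n} \<Longrightarrow> \<not> even_set R \<Longrightarrow> flag_L k n f R = 0"
  shows "relation_form k f t = 0"
proof -
  obtain S i l where t: "t = (S, i, l)"
    by (cases t)
  have max: "maximal_interval ({1..n} - S) i l"
    using assms(2) by (auto simp: t relation_index_def)
  have "flag_L k n f R * (\<Sum>j\<in>R \<inter> {i..l}. (- 1) ^ j) = 0" if "R \<in> Pow ({1..n} - S)" for R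
    using that L[of R] sum_alternating_even_set[OF _ _ max, of R] by (cases "even_set R") auto
  then have "(\<Sum>R\<in>Pow ({1..n} - S). flag_L k n f R * (\<Sum>j\<in>R \<inter> {i..l}. (- 1) ^ j)) = 0"
    by (intro sum.neutral ballI)
  then show ?thesis
    using relation_form_flag_L[OF k, of S i l n f] assms(2) unfolding t by (simp only: mult_zero_right)
qed

section \<open>Linear forms spanned by the relations\<close>

definition relation_span :: "real \<Rightarrow> nat \<Rightarrow> ((nat set \<Rightarrow> real) \<Rightarrow> real) set" where
  "relation_span k n = {F. \<exists>a. \<forall>f. F f = (\<Sum>t\<in>relation_index n. a t * relation_form k f t)}"

lemma relation_index_finite: "finite (relation_index n)"
proof (rule finite_subset)
  show "relation_index n \<subseteq> Pow {1..n} \<times> {1..n} \<times> {1..n}"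
  proof
    fix t assume "t \<in> relation_index n"
    then obtain S i l where "t = (S, i, l)" "S \<subseteq> {1..n}" "maximal_interval ({1..n} - S) i l"
      by (auto simp: relation_index_def)
    then show "t \<in> Pow {1..n} \<times> {1..n} \<times> {1..n}"
      using maximal_interval_cases(1-3)[of n S i l] by auto
  qed
qed auto

lemma relation_span_relation_form:
  assumes "t \<in> relation_index n"
  shows "(\<lambda>f. relation_form k f t) \<in> relation_span k n"
proof -
  have "relation_form k f t = (\<Sum>s\<in>relation_index n. (if s = t then 1 else 0) * relation_form k f s)"
    for f
  proof -
    have "(\<Sum>s\<in>relation_index n. (if s = t then 1 else 0) * relation_form k f s)
        = (\<Sum>s\<in>{t}. relation_form k f s)"
      by (rule sum.mono_neutral_cong_right) (use assms relation_index_finite in auto)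
    then show ?thesis
      by simp
  qed
  then show ?thesis
    unfolding relation_span_def mem_Collect_eq by (intro exI[of _ "\<lambda>s. if s = t then 1 else 0"] allI)
qed

lemma relation_span_add:
  assumes "F \<in> relation_span k n" "G \<in> relation_span k n"
  shows "(\<lambda>f. F f + G f) \<in> relation_span k n"
proof -
  obtain a b where
    "\<And>f. F f = (\<Sum>t\<in>relation_index n. a t * relation_form k f t)"
    "\<And>f. G f = (\<Sum>t\<in>relation_index n. b t * relation_form k f t)"
    using assms unfolding relation_span_def by blast
  then show ?thesis
    unfolding relation_span_def mem_Collect_eq
    by (intro exI[of _ "\<lambda>t. a t + b t"]) (simp add: distrib_right sum.distrib)
qed

lemma relation_span_scale:
  assumes "F \<in> relation_span k n"
  shows "(\<lambda>f. x * F f) \<in> relation_span k n"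
proof -
  obtain a where "\<And>f. F f = (\<Sum>t\<in>relation_index n. a t * relation_form k f t)"
    using assms unfolding relation_span_def by blast
  then show ?thesis
    unfolding relation_span_def mem_Collect_eq
    by (intro exI[of _ "\<lambda>t. x * a t"]) (simp add: sum_distrib_left mult.assoc)
qed

lemma relation_span_sum:
  assumes "\<And>x. x \<in> X \<Longrightarrow> F x \<in> relation_span k n"
  shows "(\<lambda>f. \<Sum>x\<in>X. F x f) \<in> relation_span k n"
proof -
  have zero: "(\<lambda>f. 0) \<in> relation_span k n"
    unfolding relation_span_def by (auto intro: exI[of _ "\<lambda>t. 0"])
  show ?thesis
  proof (cases "finite X")
    case True
    then show ?thesis
      using assms by (induction X) (auto simp: zero relation_span_add)
  qed (simp add: zero)
qed

text \<open>A maximal run of odd length in \<open>R\<close> gives the relation indexed by the complement of \<open>R\<close>;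
  it expresses \<open>L\<^sub>R\<close> through the \<open>L\<close>-values at proper subsets of \<open>R\<close>, of which those at even
  sets drop out.\<close>

lemma flag_L_in_relation_span:
  assumes k: "k \<noteq> 0" and "R \<subseteq> {1..n}" "\<not> even_set R"
  shows "(\<lambda>f. flag_L k n f R) \<in> relation_span k n"
proof -
  have "finite R"
    using assms(2) finite_subset by blast
  then show ?thesis
    using assms(2,3)
  proof (induction R rule: finite_psubset_induct)
    case (psubset R)
    obtain i l where max: "maximal_interval R i l" and odd: "odd (card {i..l})"
      using odd_maximal_interval psubset.hyps psubset.prems(2) by blast
    have il: "i \<le> l" "R \<inter> {i..l} = {i..l}"
      using max unfolding maximal_interval_def by blast+
    define S where "S = {1..n} - R"
    define w where "w T = (\<Sum>j\<in>T \<inter> {i..l}. (- 1 :: real) ^ j)" for T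
    define c where "c = (2 * k) ^ (card S + 1)"
    define X where "X = {T. T \<subset> R \<and> \<not> even_set T}"
    have compl: "{1..n} - S = R"
      using psubset.prems(1) by (auto simp: S_def)
    then have idx: "(S, i, l) \<in> relation_index n"
      using max by (auto simp: relation_index_def S_def)
    \<comment> \<open>A run of odd length leaves exactly one sign uncancelled, so the leading
      coefficient is invertible.\<close>
    have "w R = (- 1) ^ i"
      using il odd by (simp add: w_def sum_alternating_atLeastAtMost)
    then have w: "w R \<noteq> 0"
      by simp
    have c: "c \<noteq> 0"
      using k by (simp add: c_def)
    have rel: "relation_form k f (S, i, l) = - c * (w R * flag_L k n f R + (\<Sum>T\<in>X. w T * flag_L k n f T))"
      for f
    proof -
      have "(\<Sum>T\<in>Pow R. w T * flag_L k n f T) = (\<Sum>T\<in>insert R X. w T * flag_L k n f T)"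
      proof (rule sum.mono_neutral_right)
        show "\<forall>T\<in>Pow R - insert R X. w T * flag_L k n f T = 0"
          using sum_alternating_even_set[OF _ _ max] unfolding X_def w_def by auto
      qed (use psubset.hyps in \<open>auto simp: X_def\<close>)
      also have "\<dots> = w R * flag_L k n f R + (\<Sum>T\<in>X. w T * flag_L k n f T)"
        using psubset.hyps by (subst sum.insert) (auto simp: X_def intro: finite_subset[of _ "Pow R"])
      finally show ?thesis
        using relation_form_flag_L[OF k idx, of f] 
        unfolding compl w_def c_def by (simp only: mult.commute)
    qed
    \<comment> \<open>Used with \<open>v = w R\<close>: it isolates the leading
      \<open>L\<close>-value \<open>x\<close> from the relation, with \<open>y\<close> collecting
      the smaller sets.\<close>
    have solve: "x = - 1 / (c * v) * (- c * (v * x + y)) + - 1 / v * y" if "v \<noteq> 0" for x y v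
      using that c by (simp add: field_simps)
    have "flag_L k n f R = - 1 / (c * w R) * relation_form k f (S, i, l)
        + - 1 / w R * (\<Sum>T\<in>X. w T * flag_L k n f T)" for f
      unfolding rel by (rule solve[OF w])
    moreover have "(\<lambda>f. \<Sum>T\<in>X. w T * flag_L k n f T) \<in> relation_span k n"
      using psubset.IH psubset.prems(1)
      by (intro relation_span_sum relation_span_scale) (auto simp: X_def)
    ultimately show ?case
      by (simp only: relation_span_add relation_span_scale relation_span_relation_form[OF idx])
  qed
qed

lemma relation_span_eq_0:
  assumes "F \<in> relation_span k n" "\<And>t. t \<in> relation_index n \<Longrightarrow> relation_form k f t = 0"
  shows "F f = 0"
proof -
  obtain a where "\<And>f. F f = (\<Sum>t\<in>relation_index n. a t * relation_form k f t)"
    using assms(1) unfolding relation_span_def by blast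
  then show ?thesis
    using assms(2) by (simp add: sum.neutral)
qed

subsection \<open>Graded and \<open>k\<close>-Eulerian posets\<close>

lemma graded_poset_order:
  assumes "graded_poset r \<rho> m"
  shows "finite (Field r)" "Partial_order r" "refl_on (Field r) r" "trans r" "antisym r"
  using assms
  unfolding graded_poset_def partial_order_on_def preorder_on_def by auto

text \<open>The grading axiom speaks only of covers. A comparable pair that is no cover has an
  intermediate \<open>z\<close>, and both halves are strictly smaller intervals, which drives the
  induction.\<close>

lemma graded_poset_rank_less:
  assumes g: "graded_poset r \<rho> m" and "(x, y) \<in> r" "x \<noteq> y"
  shows "\<rho> x < \<rho> y"
  using assms(2,3)
proof (induction "card {z. (x, z) \<in> r \<and> (z, y) \<in> r}" arbitrary: x y rule: less_induct)
  case less
  note fin = graded_poset_order(1)[OF g]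
  note tr = transD[OF graded_poset_order(4)[OF g]]
  note an = antisymD[OF graded_poset_order(5)[OF g]]
  have rf: "(x, x) \<in> r" if "x \<in> Field r" for x
    using graded_poset_order(3)[OF g] that by (simp add: refl_onD)
  show ?case
  proof (cases "covers r y x")
    case True
    then show ?thesis
      using g by (auto simp: graded_poset_def)
  next
    case False
    then obtain z where z: "(x, z) \<in> r" "z \<noteq> x" "(z, y) \<in> r" "z \<noteq> y"
      using less.prems by (auto simp: covers_def)
    have fin': "finite {w. (x, w) \<in> r \<and> (w, y) \<in> r}"
      by (rule finite_subset[OF _ fin]) (auto simp: Field_def)
    have *: "(x, x) \<in> r" "(y, y) \<in> r"
      using rf less.prems(1) by (auto simp: Field_def)
    have "{w. (x, w) \<in> r \<and> (w, z) \<in> r} \<subset> {w. (x, w) \<in> r \<and> (w, y) \<in> r}"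
      using z * tr an less.prems by blast
    then have 1: "\<rho> x < \<rho> z"
      using less.hyps[OF psubset_card_mono[OF fin']] z by auto
    have "{w. (z, w) \<in> r \<and> (w, y) \<in> r} \<subset> {w. (x, w) \<in> r \<and> (w, y) \<in> r}"
      using z * tr an less.prems by blast
    then have "\<rho> z < \<rho> y"
      using less.hyps[OF psubset_card_mono[OF fin']] z by auto
    with 1 show ?thesis
      by simp
  qed
qed

definition open_interval :: "'a rel \<Rightarrow> 'a \<Rightarrow> 'a \<Rightarrow> 'a set" where
  "open_interval r x y = {z. (x, z) \<in> r \<and> z \<noteq> x \<and> (z, y) \<in> r \<and> z \<noteq> y}"

lemma minus_one_power_diff: "m \<le> n \<Longrightarrow> (- 1 :: real) ^ (n - m) = (- 1) ^ m * (- 1) ^ n"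
  by (simp flip: power_add add: minus_one_power_iff)

lemma k_moebius_unfold:
  assumes "graded_poset r \<rho> m" "x \<noteq> y"
  shows "k_moebius k r x y = - 1 - 1 / k * (\<Sum>z\<in>open_interval r x y. k_moebius k r x z)"
  using assms graded_poset_order(1,2)[OF assms(1)]
  by (subst k_moebius.simps) (simp add: open_interval_def)

text \<open>Multiplying the recursion for \<open>k_moebius\<close> by \<open>k (-1)\<^bsup>\<rho> x\<^esup>\<close> makes it symmetric in the
  two ends of the interval.\<close>

lemma k_eulerian_iff:
  assumes k: "k \<noteq> 0"
  shows "k_eulerian k r \<rho> m \<longleftrightarrow> graded_poset r \<rho> m \<and>
    (\<forall>x y. (x, y) \<in> r \<and> x \<noteq> y \<longrightarrow>
      (\<Sum>z\<in>open_interval r x y. (- 1) ^ \<rho> z) = - k * ((- 1) ^ \<rho> x + (- 1) ^ \<rho> y))"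
proof (cases "graded_poset r \<rho> m")
  case g: True
  note rank = graded_poset_rank_less[OF g]
  have step: "- 1 - 1 / k * (\<Sum>z\<in>open_interval r x y. (- 1) ^ (\<rho> z - \<rho> x)) = (- 1) ^ (\<rho> y - \<rho> x)
      \<longleftrightarrow> (\<Sum>z\<in>open_interval r x y. (- 1) ^ \<rho> z) = - k * ((- 1) ^ \<rho> x + (- 1) ^ \<rho> y)"
    if xy: "(x, y) \<in> r" "x \<noteq> y" for x y
  proof -
    define e :: real where "e = (- 1) ^ \<rho> x"
    define u :: real where "u = (- 1) ^ \<rho> y"
    define s :: real where "s = (\<Sum>z\<in>open_interval r x y. (- 1) ^ \<rho> z)"
    have "\<rho> x \<le> \<rho> z" if "z \<in> open_interval r x y" for z
      using that rank[of x z] by (auto simp: open_interval_def)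
    then have "(\<Sum>z\<in>open_interval r x y. (- 1) ^ (\<rho> z - \<rho> x)) = e * s"
      unfolding e_def s_def sum_distrib_left by (intro sum.cong refl minus_one_power_diff)
    moreover have "(- 1) ^ (\<rho> y - \<rho> x) = e * u"
      using rank[OF xy] by (simp add: minus_one_power_diff e_def u_def)
    moreover have "- 1 - 1 / k * (e * s) = e * u \<longleftrightarrow> s = - k * (e + u)"
    proof -
      \<comment> \<open>As \<open>e\<close> is its own inverse, multiplying by \<open>k * e\<close>
        turns one equation into the other up to rearrangement.\<close>
      have "e = 1 \<or> e = - 1"
        by (simp add: e_def minus_one_power_iff)
      then show ?thesis
        using k by (auto simp: field_simps)
    qed
    ultimately show ?thesis
      by (simp only: e_def u_def s_def)
  qed
  show ?thesis
  proof
    assume E: "k_eulerian k r \<rho> m"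
    then have mu: "k_moebius k r x y = (- 1) ^ (\<rho> y - \<rho> x)" if "(x, y) \<in> r" for x y
      using that by (simp add: k_eulerian_def)
    have "(\<Sum>z\<in>open_interval r x y. (- 1) ^ \<rho> z) = - k * ((- 1) ^ \<rho> x + (- 1) ^ \<rho> y)"
      if xy: "(x, y) \<in> r" "x \<noteq> y" for x y
    proof -
      have "(\<Sum>z\<in>open_interval r x y. k_moebius k r x z)
          = (\<Sum>z\<in>open_interval r x y. (- 1) ^ (\<rho> z - \<rho> x))"
        by (rule sum.cong) (auto simp: open_interval_def mu)
      then show ?thesis
        using step[OF xy] k_moebius_unfold[OF g xy(2), of k] mu[OF xy(1)] by simp
    qed
    then show "graded_poset r \<rho> m \<and> (\<forall>x y. (x, y) \<in> r \<and> x \<noteq> y \<longrightarrow>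
        (\<Sum>z\<in>open_interval r x y. (- 1) ^ \<rho> z) = - k * ((- 1) ^ \<rho> x + (- 1) ^ \<rho> y))"
      using g by blast
  next
    assume A: "graded_poset r \<rho> m \<and> (\<forall>x y. (x, y) \<in> r \<and> x \<noteq> y \<longrightarrow>
        (\<Sum>z\<in>open_interval r x y. (- 1) ^ \<rho> z) = - k * ((- 1) ^ \<rho> x + (- 1) ^ \<rho> y))"
    have "k_moebius k r x y = (- 1) ^ (\<rho> y - \<rho> x)" if "(x, y) \<in> r" for x y
      using that
    proof (induction "\<rho> y" arbitrary: y rule: less_induct)
      case less
      show ?case
      proof (cases "x = y")
        case True
        then show ?thesis
          by (simp add: k_moebius.simps)
      next
        case False
        have "(\<Sum>z\<in>open_interval r x y. k_moebius k r x z)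
            = (\<Sum>z\<in>open_interval r x y. (- 1) ^ (\<rho> z - \<rho> x))"
          by (rule sum.cong) (auto simp: open_interval_def intro!: less.hyps rank)
        then show ?thesis
          using step[OF less.prems False] k_moebius_unfold[OF g False, of k] A less.prems False
          by simp
      qed
    qed
    then show "k_eulerian k r \<rho> m"
      using g by (simp add: k_eulerian_def)
  qed
qed (simp add: k_eulerian_def)

subsection \<open>Extending chains by one rank\<close>

lemma Chains_subset_Field: "C \<in> Chains r \<Longrightarrow> C \<subseteq> Field r"
  unfolding Chains_def Field_def by blast

lemma Chains_mono: "D \<in> Chains r \<Longrightarrow> C \<subseteq> D \<Longrightarrow> C \<in> Chains r"
  unfolding Chains_def by blast

lemma finite_Chains: "finite (Field r) \<Longrightarrow> finite (Chains r)"
  by (rule finite_subset[of _ "Pow (Field r)"]) (auto dest: Chains_subset_Field)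

lemma graded_poset_Chains_inj:
  assumes g: "graded_poset r \<rho> m" and "C \<in> Chains r"
  shows "inj_on \<rho> C"
proof (rule inj_onI, rule ccontr)
  fix x y assume *: "x \<in> C" "y \<in> C" "\<rho> x = \<rho> y" "x \<noteq> y"
  then have "(x, y) \<in> r \<or> (y, x) \<in> r"
    using assms(2) unfolding Chains_def by blast
  then show False
    using graded_poset_rank_less[OF g] * by fastforce
qed

definition rank_chains :: "'a rel \<Rightarrow> ('a \<Rightarrow> nat) \<Rightarrow> nat set \<Rightarrow> 'a set set" where
  "rank_chains r \<rho> S = {C \<in> Chains r. \<rho> ` C = S}"

definition chain_extensions :: "'a rel \<Rightarrow> ('a \<Rightarrow> nat) \<Rightarrow> 'a set \<Rightarrow> nat \<Rightarrow> 'a set" where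
  "chain_extensions r \<rho> C j = {z \<in> Field r. \<rho> z = j \<and> insert z C \<in> Chains r}"

text \<open>The rank is injective on a chain, so a chain with rank set \<open>insert j S\<close>
  splits uniquely into its element of rank \<open>j\<close> and a chain with rank set
  \<open>S\<close>.\<close>

lemma flag_f_insert:
  assumes g: "graded_poset r \<rho> m" and j: "j \<notin> S"
  shows "flag_f r \<rho> (insert j S) = (\<Sum>C\<in>rank_chains r \<rho> S. card (chain_extensions r \<rho> C j))"
proof -
  note fin = graded_poset_order(1)[OF g]
  have "bij_betw (\<lambda>(C, z). insert z C) (Sigma (rank_chains r \<rho> S) (\<lambda>C. chain_extensions r \<rho> C j))
      {D \<in> Chains r. \<rho> ` D = insert j S}"
  proof (rule bij_betw_imageI)
    show "inj_on (\<lambda>(C, z). insert z C) (Sigma (rank_chains r \<rho> S) (\<lambda>C. chain_extensions r \<rho> C j))"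
    proof (rule inj_onI, clarify)
      fix C z C' z'
      assume C: "C \<in> rank_chains r \<rho> S" "C' \<in> rank_chains r \<rho> S"
        and z: "z \<in> chain_extensions r \<rho> C j" "z' \<in> chain_extensions r \<rho> C' j"
        and eq: "insert z C = insert z' C'"
      have "j \<notin> \<rho> ` C" "j \<notin> \<rho> ` C'" "\<rho> z = j" "\<rho> z' = j"
        using C z j by (simp_all add: rank_chains_def chain_extensions_def)
      then have "z \<notin> C" "z' \<notin> C" "z \<notin> C'" "z' \<notin> C'"
        by (metis imageI)+
      then show "C = C' \<and> z = z'"
        using eq by (metis insertE insertI1 insert_ident)
    qed
    show "(\<lambda>(C, z). insert z C) ` Sigma (rank_chains r \<rho> S) (\<lambda>C. chain_extensions r \<rho> C j)
        = {D \<in> Chains r. \<rho> ` D = insert j S}" (is "?L = ?R")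
    proof
      show "?L \<subseteq> ?R"
        unfolding rank_chains_def chain_extensions_def by auto
      show "?R \<subseteq> ?L"
      proof
        fix D assume "D \<in> ?R"
        then have D: "D \<in> Chains r" "\<rho> ` D = insert j S"
          by auto
        then obtain z where z: "z \<in> D" "\<rho> z = j"
          by (metis imageE insertI1)
        have "\<rho> ` (D - {z}) = S"
          using graded_poset_Chains_inj[OF g D(1)] z D(2) j
          by (subst inj_on_image_set_diff[of \<rho> D]) auto
        then have "D - {z} \<in> rank_chains r \<rho> S" "z \<in> chain_extensions r \<rho> (D - {z}) j"
          using z D Chains_mono[OF D(1), of "D - {z}"] Chains_subset_Field[OF D(1)]
          unfolding rank_chains_def chain_extensions_def by (auto simp: insert_absorb)
        then show "D \<in> ?L"
          using z by (intro image_eqI[of _ _ "(D - {z}, z)"]) auto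
      qed
    qed
  qed
  then have "flag_f r \<rho> (insert j S) = card (Sigma (rank_chains r \<rho> S) (\<lambda>C. chain_extensions r \<rho> C j))"
    unfolding flag_f_def by (rule bij_betw_same_card[symmetric])
  then show ?thesis
    using finite_Chains[OF fin] fin by (subst (asm) card_SigmaI) (auto simp: rank_chains_def chain_extensions_def)
qed

text \<open>Take \<open>x\<close> and \<open>y\<close> as the neighbours of the gap in
  \<open>C\<close> enlarged by bottom and top. The enlarged chain has no rank in
  \<open>{i..l}\<close>, so by transitivity any \<open>z\<close> between \<open>x\<close> and
  \<open>y\<close> with such a rank is comparable with all of \<open>C\<close>.\<close>

lemma chain_extensions_eq_open_interval:
  assumes g: "graded_poset r \<rho> (n + 1)" and S: "S \<subseteq> {1..n}"
    and max: "maximal_interval ({1..n} - S) i l" and C: "C \<in> rank_chains r \<rho> S"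
  obtains x y where "(x, y) \<in> r" "\<rho> x = i - 1" "\<rho> y = l + 1"
    "\<And>j. j \<in> {i..l} \<Longrightarrow> chain_extensions r \<rho> C j = {z \<in> open_interval r x y. \<rho> z = j}"
proof -
  note il = maximal_interval_cases[OF max]
  note rank = graded_poset_rank_less[OF g]
  have rf: "(x, x) \<in> r" if "x \<in> Field r" for x
    using graded_poset_order(3)[OF g] that by (simp add: refl_onD)
  note tr = transD[OF graded_poset_order(4)[OF g]]
  obtain bot top where bot: "bot \<in> Field r" "\<And>x. x \<in> Field r \<Longrightarrow> (bot, x) \<in> r" "\<rho> bot = 0"
    and top: "top \<in> Field r" "\<And>x. x \<in> Field r \<Longrightarrow> (x, top) \<in> r" "\<rho> top = n + 1"
    using g unfolding graded_poset_def by blast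
  \<comment> \<open>Bottom and top supply the ranks 0 and \<open>n + 1\<close>, which bound the gap
    when \<open>i = 1\<close> or \<open>l = n\<close>.\<close>
  define D where "D = C \<union> {bot, top}"
  have CF: "C \<subseteq> Field r" and CS: "\<rho> ` C = S" and CC: "C \<in> Chains r"
    using C Chains_subset_Field unfolding rank_chains_def by auto
  have comp: "(x, y) \<in> r \<or> (y, x) \<in> r" if "x \<in> insert z D" "y \<in> insert z D" "insert z C \<in> Chains r"
    for x y z
  proof -
    have "insert z C \<subseteq> Field r"
      using that Chains_subset_Field by blast
    then show ?thesis
      using that bot(1,2) top(1,2) unfolding D_def Chains_def by blast
  qed
  have "i - 1 \<in> \<rho> ` D" "l + 1 \<in> \<rho> ` D"
    using il(5,6) CS bot(3) top(3) by (auto simp: D_def)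
  then obtain x y where x: "x \<in> D" "\<rho> x = i - 1" and y: "y \<in> D" "\<rho> y = l + 1"
    by (metis imageE)
  have less: "(u, v) \<in> r" if "u \<in> insert z D" "v \<in> insert z D" "insert z C \<in> Chains r" "\<rho> u < \<rho> v" for u v z
    using comp[OF that(1-3)] rank[of v u] that(4) by fastforce
  \<comment> \<open>\<open>comp\<close> requires an element whose insertion keeps \<open>C\<close> a
    chain. Any member of a nonempty \<open>C\<close> serves; for \<open>C = {}\<close> only bottom
    and top have to be compared.\<close>
  have le: "(u, v) \<in> r" if "u \<in> D" "v \<in> D" "\<rho> u \<le> \<rho> v" for u v
  proof (cases "C = {}")
    case True
    then show ?thesis
      using that bot top rf by (auto simp: D_def)
  next
    case False
    then obtain z where "z \<in> C"
      by blast
    then have z: "insert z C \<in> Chains r" "D \<subseteq> insert z D"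
      using CC by (auto simp: insert_absorb)
    have "u \<in> insert z D" "v \<in> insert z D"
      using z that by auto
    then show ?thesis
      using comp[of u z v] rank[of v u] that(3) z(1) by (metis leD)
  qed
  have ranks: "\<rho> w \<le> i - 1 \<or> l + 1 \<le> \<rho> w" if "w \<in> D" for w
  proof -
    have "\<rho> w \<in> S \<or> \<rho> w = 0 \<or> \<rho> w = n + 1"
      using that CS bot(3) top(3) by (auto simp: D_def)
    moreover have "\<rho> w \<notin> {i..l}" if "\<rho> w \<in> S"
      using that il(4) by blast
    ultimately show ?thesis
      using il(1,3) by auto
  qed
  show ?thesis
  proof (rule that[of x y])
    show "(x, y) \<in> r"
      using le x y il(2) by simp
    fix j assume j: "j \<in> {i..l}"
    show "chain_extensions r \<rho> C j = {z \<in> open_interval r x y. \<rho> z = j}"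
    proof (intro set_eqI iffI)
      fix z assume "z \<in> chain_extensions r \<rho> C j"
      then have z: "\<rho> z = j" "insert z C \<in> Chains r"
        by (auto simp: chain_extensions_def)
      have "(x, z) \<in> r" "(z, y) \<in> r"
        using less[of x z z] less[of z z y] z x y j il(1) by auto
      moreover have "z \<noteq> x" "z \<noteq> y"
        using z x y j il(1) by auto
      ultimately show "z \<in> {z \<in> open_interval r x y. \<rho> z = j}"
        using z by (simp add: open_interval_def)
    next
      fix z assume "z \<in> {z \<in> open_interval r x y. \<rho> z = j}"
      then have z: "(x, z) \<in> r" "(z, y) \<in> r" "\<rho> z = j"
        by (auto simp: open_interval_def)
      then have zF: "z \<in> Field r"
        by (auto simp: Field_def)
      have "(w, z) \<in> r \<or> (z, w) \<in> r" if "w \<in> C" for w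
      proof -
        have w: "w \<in> D"
          using that by (simp add: D_def)
        then show ?thesis
          using ranks[OF w] le[OF w x(1)] le[OF y(1) w] x(2) y(2) tr z by metis
      qed
      then have "insert z C \<in> Chains r"
        using CC rf[OF zF] unfolding Chains_def by blast
      then show "z \<in> chain_extensions r \<rho> C j"
        using z zF by (simp add: chain_extensions_def)
    qed
  qed (use x y in auto)
qed

text \<open>Grouping an open interval by rank shows that every chain with rank set \<open>S\<close>
  has the same signed number of one-element extensions, namely \<open>- e\<close>. Summing over
  these chains gives \<open>- e\<close> times the flag number at \<open>S\<close>, which is
  (1).\<close>

lemma k_eulerian_relation_form:
  assumes k: "k \<noteq> 0" and E: "k_eulerian k r \<rho> (n + 1)"
    and S: "S \<subseteq> {1..n}" and max: "maximal_interval ({1..n} - S) i l"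
  shows "relation_form k (\<lambda>T. real (flag_f r \<rho> T)) (S, i, l) = 0"
proof -
  have g: "graded_poset r \<rho> (n + 1)"
    using E by (simp add: k_eulerian_def)
  note fin = graded_poset_order(1)[OF g]
  note il = maximal_interval_cases[OF max]
  define e :: real where "e = k * ((- 1) ^ (i - 1) + (- 1) ^ (l + 1))"
  have count: "(\<Sum>j=i..l. (- 1) ^ j * real (card (chain_extensions r \<rho> C j))) = - e"
    if C: "C \<in> rank_chains r \<rho> S" for C
  proof -
    obtain x y where xy: "(x, y) \<in> r" "\<rho> x = i - 1" "\<rho> y = l + 1"
      and ext: "\<And>j. j \<in> {i..l} \<Longrightarrow> chain_extensions r \<rho> C j = {z \<in> open_interval r x y. \<rho> z = j}"
      using chain_extensions_eq_open_interval[OF g S max C] by metis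
    have finI: "finite (open_interval r x y)"
      by (rule finite_subset[OF _ fin]) (auto simp: open_interval_def Field_def)
    have range: "\<rho> ` open_interval r x y \<subseteq> {i..l}"
    proof
      fix j assume "j \<in> \<rho> ` open_interval r x y"
      then obtain z where z: "j = \<rho> z" "(x, z) \<in> r" "z \<noteq> x" "(z, y) \<in> r" "z \<noteq> y"
        by (auto simp: open_interval_def)
      then show "j \<in> {i..l}"
        using graded_poset_rank_less[OF g, of x z] graded_poset_rank_less[OF g, of z y] xy(2,3) by auto
    qed
    have "(\<Sum>j=i..l. (- 1) ^ j * real (card (chain_extensions r \<rho> C j)))
        = (\<Sum>j=i..l. \<Sum>z\<in>{z \<in> open_interval r x y. \<rho> z = j}. (- 1) ^ \<rho> z)"
      by (intro sum.cong refl) (simp add: ext)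
    also have "\<dots> = (\<Sum>z\<in>open_interval r x y. (- 1) ^ \<rho> z)"
      by (rule sum.group[OF finI _ range]) simp
    also have "\<dots> = - e"
    proof -
      have "x \<noteq> y"
        using xy il(1,2) by auto
      then show ?thesis
        using E xy unfolding k_eulerian_iff[OF k] e_def by simp
    qed
    finally show ?thesis .
  qed
  have "(\<Sum>j=i..l. (- 1) ^ j * real (flag_f r \<rho> (S \<union> {j})))
      = (\<Sum>j=i..l. \<Sum>C\<in>rank_chains r \<rho> S. (- 1) ^ j * real (card (chain_extensions r \<rho> C j)))"
  proof (rule sum.cong[OF refl])
    fix j assume "j \<in> {i..l}"
    then have "j \<notin> S"
      using il(4) by blast
    then show "(- 1) ^ j * real (flag_f r \<rho> (S \<union> {j}))
        = (\<Sum>C\<in>rank_chains r \<rho> S. (- 1) ^ j * real (card (chain_extensions r \<rho> C j)))"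
      using flag_f_insert[OF g] by (simp add: sum_distrib_left)
  qed
  also have "\<dots> = (\<Sum>C\<in>rank_chains r \<rho> S. \<Sum>j=i..l. (- 1) ^ j * real (card (chain_extensions r \<rho> C j)))"
    by (rule sum.swap)
  also have "\<dots> = (\<Sum>C\<in>rank_chains r \<rho> S. - e)"
    using count by (intro sum.cong refl)
  also have "\<dots> = - e * real (flag_f r \<rho> S)"
    by (simp add: flag_f_def rank_chains_def)
  finally show ?thesis
    unfolding relation_form_def split e_def[symmetric] by (simp only:)
qed

subsection \<open>Posets with doubled blocks\<close>

text \<open>From a chain of rank \<open>n + 1\<close>, each inner rank is replaced by \<open>m\<close> incomparable copies, and each
  block \<open>I \<in> Q\<close> of ranks is replaced by two sheets, where elements of different sheets of
  the same block are incomparable. An element of rank \<open>j\<close> is encoded as \<open>prod_encode (j, c)\<close>, where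
  the parity of \<open>c\<close> is the sheet. Since the blocks are intervals of even length, the second
  sheets do not contribute to the alternating sums in \<open>k_eulerian_iff\<close>.\<close>

locale block_poset =
  fixes n m :: nat and S :: "nat set" and Q :: "nat set set"
  assumes m_pos: "0 < m"
    and blocks: "even_interval_partition S Q"
    and S_subset: "S \<subseteq> {1..n}"
begin

definition rank :: "nat \<Rightarrow> nat" where "rank x = fst (prod_decode x)"

definition col :: "nat \<Rightarrow> nat" where "col x = snd (prod_decode x)"

text \<open>Even colours alone give \<open>m\<close> copies of a rank; both parities give two sheets
  of \<open>m\<close>. Ranks 0 and \<open>n + 1\<close> get a single colour so that bottom and top
  are unique.\<close>

definition elems :: "nat set" where
  "elems = {x. rank x \<le> n + 1 \<and> col x < 2 * m \<and> (rank x \<notin> S \<longrightarrow> even (col x)) \<and>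
     (rank x \<notin> {1..n} \<longrightarrow> col x = 0)}"

definition compatible :: "nat \<Rightarrow> nat \<Rightarrow> bool" where
  "compatible x y \<longleftrightarrow> (\<forall>I\<in>Q. rank x \<in> I \<and> rank y \<in> I \<longrightarrow> even (col x) = even (col y))"

definition ord :: "nat rel" where
  "ord = {(x, y). x \<in> elems \<and> y \<in> elems \<and> (x = y \<or> rank x < rank y \<and> compatible x y)}"

lemma rank_encode [simp]: "rank (prod_encode (j, c)) = j"
  and col_encode [simp]: "col (prod_encode (j, c)) = c"
  by (simp_all add: rank_def col_def)

lemma encode_rank_col [simp]: "prod_encode (rank x, col x) = x"
  by (simp add: rank_def col_def)

lemma S_eq: "S = \<Union>Q"
  and blocks_unique: "I \<in> Q \<Longrightarrow> J \<in> Q \<Longrightarrow> j \<in> I \<Longrightarrow> j \<in> J \<Longrightarrow> I = J"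
  using blocks unfolding even_interval_partition_def partition_on_def disjoint_def by blast+

lemma finite_blocks: "finite Q"
proof (rule finite_elements)
  show "finite S"
    using S_subset finite_subset by blast
  show "partition_on S Q"
    using blocks by (simp add: even_interval_partition_def)
qed

lemma block_convex:
  assumes "I \<in> Q" "a \<in> I" "b \<in> I" "a \<le> j" "j \<le> b"
  shows "j \<in> I"
proof -
  obtain u v where "I = {u..v}"
    using blocks assms(1) unfolding even_interval_partition_def by blast
  then show ?thesis
    using assms by auto
qed

lemma compatible_sym: "compatible x y \<longleftrightarrow> compatible y x"
  unfolding compatible_def by blast

text \<open>Blocks are convex, so a block containing both outer ranks contains the middle one, which
  transports the sheet.\<close>

lemma compatible_trans:
  assumes "compatible x y" "compatible y z" "rank x \<le> rank y" "rank y \<le> rank z"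
  shows "compatible x z"
  unfolding compatible_def
proof (intro ballI impI)
  fix I assume I: "I \<in> Q" "rank x \<in> I \<and> rank z \<in> I"
  then have "rank y \<in> I"
    using block_convex assms(3,4) by blast
  then show "even (col x) = even (col z)"
    using assms(1,2) I unfolding compatible_def by blast
qed

lemma compatible_refl: "compatible x x"
  by (simp add: compatible_def)

lemma Field_ord: "Field ord = elems"
  unfolding Field_def ord_def by auto

lemma finite_elems: "finite elems"
proof (rule finite_subset)
  show "elems \<subseteq> prod_encode ` ({..n + 1} \<times> {..<2 * m})"
  proof
    fix x assume "x \<in> elems"
    then show "x \<in> prod_encode ` ({..n + 1} \<times> {..<2 * m})"
      by (intro image_eqI[of _ _ "(rank x, col x)"]) (auto simp: elems_def)
  qed
qed simp

lemma Partial_order_ord: "Partial_order ord"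
proof -
  have "refl_on (Field ord) ord"
    unfolding Field_ord by (auto simp: refl_on_def ord_def)
  moreover have "trans ord"
  proof (rule transI)
    fix x y z assume "(x, y) \<in> ord" "(y, z) \<in> ord"
    then show "(x, z) \<in> ord"
      using compatible_trans[of x y z] by (auto simp: ord_def)
  qed
  moreover have "antisym ord"
    by (rule antisymI) (auto simp: ord_def)
  moreover have "ord \<subseteq> Field ord \<times> Field ord"
    unfolding Field_def by auto
  ultimately show ?thesis
    by (simp add: partial_order_on_def preorder_on_def)
qed

section \<open>Counting elements and chains in the block poset\<close>

lemma card_parity: "card {c. c < 2 * m \<and> even c = b} = m"
proof -
  have "{c. c < 2 * m \<and> even c = b} = (\<lambda>i. 2 * i + of_bool (\<not> b)) ` {..<m}"
  proof
    show "{c. c < 2 * m \<and> even c = b} \<subseteq> (\<lambda>i. 2 * i + of_bool (\<not> b)) ` {..<m}"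
    proof
      fix c assume "c \<in> {c. c < 2 * m \<and> even c = b}"
      then show "c \<in> (\<lambda>i. 2 * i + of_bool (\<not> b)) ` {..<m}"
        by (intro image_eqI[of _ _ "c div 2"]) (auto simp: of_bool_def elim!: oddE)
    qed
  qed (auto simp: of_bool_def)
  moreover have "inj_on (\<lambda>i. 2 * i + of_bool (\<not> b)) {..<m}"
    by (rule inj_onI) simp
  ultimately show ?thesis
    by (simp add: card_image)
qed

text \<open>One sheet is available outside all blocks, and both in a block that \<open>C\<close>
  does not meet. In a block met by \<open>C\<close> the sheet is forced, since pairwise compatible
  elements agree on it. The lemma serves for chains and for the pair of ends of an interval.\<close>

lemma card_compatible_layer:
  assumes j: "j \<in> {1..n}" and C: "\<And>x y. x \<in> C \<Longrightarrow> y \<in> C \<Longrightarrow> compatible x y"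
  shows "card {z \<in> elems. rank z = j \<and> (\<forall>y\<in>C. compatible z y)} =
    m * (if \<exists>I\<in>Q. j \<in> I \<and> I \<inter> rank ` C = {} then 2 else 1)"
proof -
  \<comment> \<open>An element of rank \<open>j\<close> is determined by its colour, so it suffices
    to count colours.\<close>
  have image: "card {z \<in> elems. rank z = j \<and> (\<forall>y\<in>C. compatible z y)} = card {c. P c}"
    if P: "\<And>z. rank z = j \<Longrightarrow> z \<in> elems \<and> (\<forall>y\<in>C. compatible z y) \<longleftrightarrow> P (col z)" for P
  proof -
    have "{z \<in> elems. rank z = j \<and> (\<forall>y\<in>C. compatible z y)} = (\<lambda>c. prod_encode (j, c)) ` {c. P c}"
    proof (intro set_eqI iffI)
      fix z assume "z \<in> {z \<in> elems. rank z = j \<and> (\<forall>y\<in>C. compatible z y)}"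
      then show "z \<in> (\<lambda>c. prod_encode (j, c)) ` {c. P c}"
        using P[of z] by (intro image_eqI[of _ _ "col z"]) auto
    next
      fix z assume "z \<in> (\<lambda>c. prod_encode (j, c)) ` {c. P c}"
      then show "z \<in> {z \<in> elems. rank z = j \<and> (\<forall>y\<in>C. compatible z y)}"
        using P[of z] by auto
    qed
    moreover have "inj_on (\<lambda>c. prod_encode (j, c)) {c. P c}"
      by (rule inj_onI) simp
    ultimately show ?thesis
      by (simp add: card_image)
  qed
  have elems_layer: "z \<in> elems \<longleftrightarrow> col z < 2 * m \<and> (j \<notin> S \<longrightarrow> even (col z))" if "rank z = j" for z
    using that j by (auto simp: elems_def)
  consider (single) "j \<notin> S"
    | (free) I where "I \<in> Q" "j \<in> I" "I \<inter> rank ` C = {}"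
    | (bound) I y where "I \<in> Q" "j \<in> I" "y \<in> C" "rank y \<in> I"
    using S_eq by blast
  then show ?thesis
  proof cases
    case single
    have no_block: "\<not> (\<exists>I\<in>Q. j \<in> I)"
      using single S_eq by blast
    then have "compatible z y" if "rank z = j" for z y
      using that unfolding compatible_def by blast
    then have "card {z \<in> elems. rank z = j \<and> (\<forall>y\<in>C. compatible z y)} = card {c. c < 2 * m \<and> even c = True}"
      using single by (intro image) (auto simp: elems_layer)
    then show ?thesis
      using no_block unfolding card_parity by auto
  next
    case free
    have "compatible z y" if "rank z = j" "y \<in> C" for z y
      unfolding compatible_def using that free blocks_unique by blast
    moreover have inS: "j \<in> S"
      using free S_eq by blast
    ultimately have "card {z \<in> elems. rank z = j \<and> (\<forall>y\<in>C. compatible z y)} = card {c. c < 2 * m}"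
      using inS by (intro image) (auto simp: elems_layer)
    then show ?thesis
      using free by auto
  next
    case bound
    have "(\<forall>w\<in>C. compatible z w) \<longleftrightarrow> even (col z) = even (col y)" if z: "rank z = j" for z
    proof
      assume *: "even (col z) = even (col y)"
      show "\<forall>w\<in>C. compatible z w"
        unfolding compatible_def
      proof (intro ballI impI)
        fix w J assume "w \<in> C" "J \<in> Q" "rank z \<in> J \<and> rank w \<in> J"
        moreover from this have "J = I"
          using blocks_unique bound z by blast
        ultimately show "even (col z) = even (col w)"
          using C[of y w] * bound unfolding compatible_def by blast
      qed
    qed (use bound z in \<open>auto simp: compatible_def\<close>)
    moreover have inS: "j \<in> S"
      using bound S_eq by blast
    ultimately have "card {z \<in> elems. rank z = j \<and> (\<forall>y\<in>C. compatible z y)}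
        = card {c. c < 2 * m \<and> even c = even (col y)}"
      using inS by (intro image) (auto simp: elems_layer)
    moreover have "\<not> (\<exists>I\<in>Q. j \<in> I \<and> I \<inter> rank ` C = {})"
      using bound blocks_unique by blast
    ultimately show ?thesis
      by (simp only: card_parity if_False mult_1_right)
  qed
qed

lemma open_interval_ord:
  assumes "(x, y) \<in> ord" "rank x < j" "j < rank y"
  shows "{z \<in> open_interval ord x y. rank z = j}
    = {z \<in> elems. rank z = j \<and> (\<forall>w\<in>{x, y}. compatible z w)}"
  using assms compatible_sym[of x] by (auto simp: open_interval_def ord_def)

lemma card_open_interval_ord:
  assumes xy: "(x, y) \<in> ord" and j: "rank x < j" "j < rank y"
  shows "card {z \<in> open_interval ord x y. rank z = j}
    = m * (if \<exists>I\<in>Q. j \<in> I \<and> I \<inter> rank ` {x, y} = {} then 2 else 1)"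
  unfolding open_interval_ord[OF assms]
proof (rule card_compatible_layer)
  show "j \<in> {1..n}"
    using xy j by (auto simp: ord_def elems_def)
  have "compatible x y"
    using xy j by (auto simp: ord_def)
  then show "compatible u v" if "u \<in> {x, y}" "v \<in> {x, y}" for u v
    using that compatible_refl compatible_sym by blast
qed

lemma graded_poset_ord: "graded_poset ord rank (n + 1)"
proof -
  define b t where "b = prod_encode (0, 0)" and "t = prod_encode (n + 1, 0)"
  have "b \<in> elems" "t \<in> elems"
    using m_pos by (auto simp: b_def t_def elems_def)
  \<comment> \<open>Blocks lie within \<open>{1..n}\<close>, so the ranks of \<open>b\<close> and
    \<open>t\<close> belong to no block.\<close>
  moreover have "compatible b x" "compatible x t" for x
    using S_subset S_eq unfolding compatible_def b_def t_def by fastforce+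
  moreover have "b = x" if "x \<in> elems" "rank x = 0" for x
    using that encode_rank_col[of x] by (auto simp: b_def elems_def)
  moreover have "t = x" if "x \<in> elems" "rank x \<ge> n + 1" for x
    using that encode_rank_col[of x] by (auto simp: t_def elems_def)
  moreover have "rank b = 0" "rank t = n + 1"
    by (simp_all add: b_def t_def)
  moreover have "rank x = 0 \<or> 0 < rank x" "rank x \<ge> n + 1 \<or> rank x < n + 1" for x
    by auto
  ultimately have "(b, x) \<in> ord" "(x, t) \<in> ord" if "x \<in> elems" for x
    using that unfolding ord_def mem_Collect_eq split by metis+
  moreover have "rank y = rank x + 1" if c: "covers ord y x" for x y
  proof (rule ccontr)
    assume "rank y \<noteq> rank x + 1"
    then have xy: "(x, y) \<in> ord" "rank x < rank x + 1" "rank x + 1 < rank y"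
      using c by (auto simp: covers_def ord_def)
    \<comment> \<open>If a cover skipped a rank, the layer just above \<open>x\<close> would still
      put at least \<open>m\<close> elements into the open interval.\<close>
    have "card {z \<in> open_interval ord x y. rank z = rank x + 1} > 0"
      unfolding card_open_interval_ord[OF xy] using m_pos by simp
    then have "open_interval ord x y \<noteq> {}"
      by fastforce
    then show False
      using c by (auto simp: covers_def open_interval_def)
  qed
  moreover have "Partial_order ord \<and> finite (Field ord)"
    using Partial_order_ord finite_elems by (simp add: Field_ord)
  ultimately show ?thesis
    unfolding graded_poset_def
    using \<open>b \<in> elems\<close> \<open>t \<in> elems\<close> \<open>rank b = 0\<close> \<open>rank t = n + 1\<close> by (metis Field_ord)
qed

text \<open>Each rank strictly between the ends contributes \<open>m\<close> elements, and
  \<open>m\<close> more if it lies in a block avoiding both end ranks. By convexity such a block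
  lies wholly inside or outside the rank interval, so the extra terms cancel and the rest is the
  value required for \<open>k = m / 2\<close>.\<close>

lemma k_eulerian_ord: "k_eulerian (real m / 2) ord rank (n + 1)"
proof -
  have "(\<Sum>z\<in>open_interval ord x y. (- 1) ^ rank z) = - (real m / 2) * ((- 1) ^ rank x + (- 1) ^ rank y)"
    if xy: "(x, y) \<in> ord" "x \<noteq> y" for x y
  proof -
    define J where "J = {rank x<..<rank y}"
    define P where "P = {I \<in> Q. I \<inter> rank ` {x, y} = {}}"
    have less: "rank x < rank y"
      using xy by (auto simp: ord_def)
    have finI: "finite (open_interval ord x y)"
      by (rule finite_subset[OF _ finite_elems]) (auto simp: open_interval_def ord_def)
    have range: "rank ` open_interval ord x y \<subseteq> J"
      by (auto simp: open_interval_def ord_def J_def)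
    have "even_interval_partition (\<Union>P) P"
      by (rule even_interval_partition_subset[OF blocks]) (auto simp: P_def)
    moreover have "I \<subseteq> J \<or> I \<inter> J = {}" if I: "I \<in> P" for I
    proof (rule ccontr)
      assume "\<not> (I \<subseteq> J \<or> I \<inter> J = {})"
      then obtain a c where ac: "a \<in> I" "a \<in> J" "c \<in> I" "c \<notin> J"
        by blast
      have IQ: "I \<in> Q" "rank x \<notin> I" "rank y \<notin> I"
        using I by (auto simp: P_def)
      show False
        using ac IQ block_convex[OF IQ(1) ac(3) ac(1), of "rank x"]
          block_convex[OF IQ(1) ac(1) ac(3), of "rank y"] by (auto simp: J_def)
    qed
    ultimately have zero: "(\<Sum>j\<in>\<Union>P \<inter> J. (- 1) ^ j) = (0 :: real)"
      by (rule sum_alternating_blocks)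
    have "(\<Sum>z\<in>open_interval ord x y. (- 1) ^ rank z)
        = (\<Sum>j\<in>J. \<Sum>z\<in>{z \<in> open_interval ord x y. rank z = j}. (- 1 :: real) ^ rank z)"
      by (rule sum.group[symmetric, OF finI _ range]) (simp add: J_def)
    also have "\<dots> = (\<Sum>j\<in>J. real m * (- 1) ^ j + (if j \<in> \<Union>P then real m * (- 1) ^ j else 0))"
    proof (rule sum.cong[OF refl])
      fix j assume "j \<in> J"
      then have "card {z \<in> open_interval ord x y. rank z = j}
          = m * (if j \<in> \<Union>P then 2 else 1)"
        using card_open_interval_ord[OF xy(1), of j] by (auto simp: J_def P_def)
      then show "(\<Sum>z\<in>{z \<in> open_interval ord x y. rank z = j}. (- 1 :: real) ^ rank z)
          = real m * (- 1) ^ j + (if j \<in> \<Union>P then real m * (- 1) ^ j else 0)"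
        by simp
    qed
    also have "\<dots> = real m * (\<Sum>j\<in>J. (- 1) ^ j) + real m * (\<Sum>j\<in>\<Union>P \<inter> J. (- 1) ^ j)"
    proof -
      have "(\<Sum>j\<in>J. if j \<in> \<Union>P then real m * (- 1) ^ j else 0) = (\<Sum>j\<in>\<Union>P \<inter> J. real m * (- 1) ^ j)"
        by (rule sum.mono_neutral_cong_right) (auto simp: J_def)
      then show ?thesis
        unfolding sum.distrib by (simp add: sum_distrib_left)
    qed
    also have "\<dots> = - (real m / 2) * ((- 1) ^ rank x + (- 1) ^ rank y)"
      unfolding zero unfolding J_def sum_alternating_greaterThanLessThan[OF less]
      by (simp add: field_simps)
    finally show ?thesis .
  qed
  then show ?thesis
    using graded_poset_ord m_pos by (subst k_eulerian_iff) auto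
qed

text \<open>Each further rank multiplies the count by \<open>m\<close>, with an additional factor 2
  on the first entry into a block, where the sheet is chosen.\<close>

lemma flag_f_ord:
  assumes "T \<subseteq> {1..n}"
  shows "flag_f ord rank T = m ^ card T * 2 ^ card {I \<in> Q. I \<inter> T \<noteq> {}}"
proof -
  have "finite T"
    using assms finite_subset by blast
  then show ?thesis
    using assms
  proof (induction T)
    case empty
    have "{C \<in> Chains ord. rank ` C = {}} = {{}}"
      by (auto simp: Chains_def)
    then show ?case
      by (simp add: flag_f_def)
  next
    case (insert j T)
    define d :: nat where "d = (if \<exists>I\<in>Q. j \<in> I \<and> I \<inter> T = {} then 2 else 1)"
    have "card (chain_extensions ord rank C j) = m * d" if "C \<in> rank_chains ord rank T" for C
    proof -
      have C: "C \<in> Chains ord" "rank ` C = T"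
        using that by (auto simp: rank_chains_def)
      have compat: "compatible x y" if "x \<in> C" "y \<in> C" for x y
      proof -
        have "(x, y) \<in> ord \<or> (y, x) \<in> ord"
          using C(1) that unfolding Chains_def by blast
        then show ?thesis
          using compatible_refl compatible_sym[of x y] by (auto simp: ord_def)
      qed
      have "chain_extensions ord rank C j = {z \<in> elems. rank z = j \<and> (\<forall>y\<in>C. compatible z y)}"
      proof (intro set_eqI iffI)
        fix z assume z: "z \<in> chain_extensions ord rank C j"
        have "compatible z y" if "y \<in> C" for y
        proof -
          have "(z, y) \<in> ord \<or> (y, z) \<in> ord"
            using z that unfolding chain_extensions_def Chains_def by blast
          then show ?thesis
            using compatible_refl compatible_sym[of z y] by (auto simp: ord_def)
        qed
        then show "z \<in> {z \<in> elems. rank z = j \<and> (\<forall>y\<in>C. compatible z y)}"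
          using z by (auto simp: chain_extensions_def Field_ord)
      next
        fix z assume z: "z \<in> {z \<in> elems. rank z = j \<and> (\<forall>y\<in>C. compatible z y)}"
        have "(z, y) \<in> ord \<or> (y, z) \<in> ord" if y: "y \<in> C" for y
        proof -
          have "y \<in> elems"
            using Chains_subset_Field[OF C(1)] y Field_ord by blast
          moreover have "rank y \<noteq> rank z"
            using z imageI[OF y, of rank] C(2) insert.hyps(2) by auto
          ultimately show ?thesis
            using z y compatible_sym[of z y] by (auto simp: ord_def)
        qed
        moreover have "(z, z) \<in> ord"
          using z by (simp add: ord_def)
        ultimately have "insert z C \<in> Chains ord"
          using C(1) unfolding Chains_def by blast
        then show "z \<in> chain_extensions ord rank C j"
          using z by (simp add: chain_extensions_def Field_ord)
      qed
      then show ?thesis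
        using card_compatible_layer[of j C, OF _ compat] insert.prems C(2) by (simp add: d_def)
    qed
    then have "flag_f ord rank (insert j T) = flag_f ord rank T * (m * d)"
      unfolding flag_f_insert[OF graded_poset_ord insert.hyps(2)]
      by (simp add: flag_f_def rank_chains_def)
    moreover have "2 ^ card {I \<in> Q. I \<inter> insert j T \<noteq> {}} = d * 2 ^ card {I \<in> Q. I \<inter> T \<noteq> {}}"
    proof -
      show ?thesis
      proof (cases "\<exists>I\<in>Q. j \<in> I \<and> I \<inter> T = {}")
        case True
        then obtain I where I: "I \<in> Q" "j \<in> I" "I \<inter> T = {}"
          by blast
        then have "{I \<in> Q. I \<inter> insert j T \<noteq> {}} = insert I {I \<in> Q. I \<inter> T \<noteq> {}}"
          using blocks_unique by blast
        then show ?thesis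
          using finite_blocks I True by (simp add: d_def)
      next
        case False
        then have "{I \<in> Q. I \<inter> insert j T \<noteq> {}} = {I \<in> Q. I \<inter> T \<noteq> {}}"
          by blast
        then show ?thesis
          using False by (simp add: d_def)
      qed
    qed
    ultimately show ?case
      using insert by simp
  qed
qed

end

subsection \<open>Completeness of the relations\<close>

text \<open>A block contributes the factor \<open>- 1 + 2\<close> if it avoids \<open>U\<close> and
  \<open>0 + 2\<close> otherwise. In the expanded product, \<open>A\<close> collects the blocks
  where the first summand is taken. Disjointness of \<open>\<Union>A\<close> and \<open>U\<close>
  matches the inversion formula for \<open>L\<close>.\<close>

lemma power_2_card_meeting:
  assumes "finite Q"
  shows "2 ^ card {I \<in> Q. I \<inter> U \<noteq> {}}
    = (\<Sum>A\<in>Pow Q. if \<Union>A \<inter> U = {} then (- 1) ^ card A * 2 ^ card (Q - A) else 0 :: real)"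
proof -
  have "(2 :: real) ^ card {I \<in> Q. I \<inter> U \<noteq> {}} = (\<Prod>I\<in>Q. if I \<inter> U \<noteq> {} then 2 else 1)"
    using assms by (simp add: prod.If_cases Int_def)
  also have "\<dots> = (\<Prod>I\<in>Q. (if I \<inter> U = {} then - 1 else 0) + 2)"
    by (rule prod.cong) auto
  also have "\<dots> = (\<Sum>A\<in>Pow Q. (\<Prod>I\<in>A. if I \<inter> U = {} then - 1 else 0) * 2 ^ card (Q - A))"
    by (subst prod_add[OF assms]) simp
  also have "\<dots> = (\<Sum>A\<in>Pow Q. if \<Union>A \<inter> U = {} then (- 1) ^ card A * 2 ^ card (Q - A) else 0)"
  proof (rule sum.cong[OF refl])
    fix A assume "A \<in> Pow Q"
    then have fin: "finite A"
      using assms finite_subset by blast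
    have "(\<Prod>I\<in>A. if I \<inter> U = {} then - 1 else 0 :: real) = (if \<Union>A \<inter> U = {} then (- 1) ^ card A else 0)"
    proof (cases "\<Union>A \<inter> U = {}")
      case True
      then have "(\<Prod>I\<in>A. if I \<inter> U = {} then - 1 else 0 :: real) = (\<Prod>I\<in>A. - 1)"
        by (intro prod.cong) auto
      then show ?thesis
        using True by simp
    next
      case False
      then show ?thesis
        using fin by (auto intro!: prod_zero)
    qed
    then show "(\<Prod>I\<in>A. if I \<inter> U = {} then - 1 else 0 :: real) * 2 ^ card (Q - A)
        = (if \<Union>A \<inter> U = {} then (- 1) ^ card A * 2 ^ card (Q - A) else 0)"
      by simp
  qed
  finally show ?thesis .
qed

text \<open>By \<open>power_2_card_meeting\<close>, the flag vector of the poset with blocks \<open>Q\<close> has nonzero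
  \<open>L\<close>-values only at unions of blocks, so evaluating an identity on these posets yields a
  triangular system for its coefficients at even sets.\<close>

lemma even_coefficient_eq_0:
  fixes m :: nat
  assumes m: "0 < m"
    and c: "\<And>(r :: nat rel) \<rho>. k_eulerian (real m / 2) r \<rho> (n + 1) \<Longrightarrow>
      (\<Sum>U\<in>Pow {1..n}. c U * real (flag_f r \<rho> U)) = 0"
    and R: "R \<subseteq> {1..n}" "even_set R"
  shows "(\<Sum>U\<in>Pow ({1..n} - R). c U * real m ^ card U) = 0"
proof -
  have "finite R"
    using R finite_subset by blast
  then show ?thesis
    using R
  proof (induction R rule: finite_psubset_induct)
    case (psubset R)
    obtain Q where Q: "even_interval_partition R Q"
      using psubset.prems by (auto simp: even_set_iff)
    interpret block_poset n m R Q
      by standard (use m Q psubset.prems in auto)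
    define d where "d T = (\<Sum>U\<in>Pow ({1..n} - T). c U * real m ^ card U)" for T
    define e :: "nat set set \<Rightarrow> real" where "e A = (- 1) ^ card A * 2 ^ card (Q - A)" for A
    have d: "d T = (\<Sum>U\<in>Pow {1..n}. if T \<inter> U = {} then c U * real m ^ card U else 0)" for T
      unfolding d_def by (rule sum.mono_neutral_cong_left) auto
    have "0 = (\<Sum>U\<in>Pow {1..n}. c U * real (flag_f ord rank U))"
      using c[OF k_eulerian_ord] by simp
    also have "\<dots> = (\<Sum>U\<in>Pow {1..n}. \<Sum>A\<in>Pow Q. e A * (if \<Union>A \<inter> U = {} then c U * real m ^ card U else 0))"
    proof (rule sum.cong[OF refl])
      fix U assume "U \<in> Pow {1..n}"
      then have "c U * real (flag_f ord rank U)
          = c U * real m ^ card U * (\<Sum>A\<in>Pow Q. if \<Union>A \<inter> U = {} then e A else 0)"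
        using power_2_card_meeting[OF finite_blocks, of U] flag_f_ord[of U] unfolding e_def by simp
      also have "\<dots> = (\<Sum>A\<in>Pow Q. e A * (if \<Union>A \<inter> U = {} then c U * real m ^ card U else 0))"
        unfolding sum_distrib_left by (intro sum.cong) auto
      finally show "c U * real (flag_f ord rank U)
          = (\<Sum>A\<in>Pow Q. e A * (if \<Union>A \<inter> U = {} then c U * real m ^ card U else 0))" .
    qed
    also have "\<dots> = (\<Sum>A\<in>Pow Q. e A * d (\<Union>A))"
      by (subst sum.swap) (simp add: d sum_distrib_left)
    also have "\<dots> = (\<Sum>A\<in>{Q}. e A * d (\<Union>A))"
    proof (rule sum.mono_neutral_right)
      show "\<forall>A\<in>Pow Q - {Q}. e A * d (\<Union>A) = 0"
      proof
        \<comment> \<open>An omitted block is nonempty, so the union of \<open>A\<close> is strictly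
          smaller than \<open>R\<close>. It is still even, and the induction hypothesis
          applies.\<close>
        fix A assume "A \<in> Pow Q - {Q}"
        then have A: "A \<subseteq> Q" "A \<noteq> Q"
          by auto
        then obtain I where I: "I \<in> Q" "I \<notin> A"
          by blast
        then obtain j where "j \<in> I"
          using Q partition_onD3 unfolding even_interval_partition_def by fastforce
        then have "j \<in> R" "j \<notin> \<Union>A"
          using A I blocks_unique S_eq by blast+
        then have "\<Union>A \<subset> R"
          using A S_eq by blast
        moreover have "even_set (\<Union>A)"
          using even_interval_partition_subset[OF Q A(1)] by (auto simp: even_set_iff)
        ultimately have "d (\<Union>A) = 0"
          using psubset.IH[of "\<Union>A"] psubset.prems unfolding d_def by blast
        then show "e A * d (\<Union>A) = 0"
          by simp
      qed
    qed (use finite_blocks in auto)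
    \<comment> \<open>For \<open>A = Q\<close> the power of 2 is trivial and the coefficient of
      \<open>d R\<close> is a sign, hence nonzero.\<close>
    also have "\<dots> = (- 1) ^ card Q * d R"
      by (simp add: e_def flip: S_eq)
    finally show ?case
      by (simp add: d_def)
  qed
qed

theorem mainTheorem8:
  fixes k :: real and n :: nat
  assumes "2 * k \<in> \<nat>" and "2 * k > 0"
  shows "(\<forall>(r :: 'a rel) \<rho>. k_eulerian k r \<rho> (n + 1) \<longrightarrow>
            (\<forall>S i l. S \<subseteq> {1..n} \<and> maximal_interval ({1..n} - S) i l \<longrightarrow>
               relation_form k (\<lambda>T. real (flag_f r \<rho> T)) (S, i, l) = 0))
       \<and> (\<forall>c :: nat set \<Rightarrow> real.
            (\<forall>(r :: nat rel) \<rho>. k_eulerian k r \<rho> (n + 1) \<longrightarrow>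
               (\<Sum>S\<in>Pow {1..n}. c S * real (flag_f r \<rho> S)) = 0) \<longrightarrow>
            (\<exists>a :: nat set \<times> nat \<times> nat \<Rightarrow> real. \<forall>f :: nat set \<Rightarrow> real.
               (\<Sum>S\<in>Pow {1..n}. c S * f S) =
               (\<Sum>t\<in>relation_index n. a t * relation_form k f t)))
       \<and> (\<forall>f :: nat set \<Rightarrow> real.
            (\<forall>t\<in>relation_index n. relation_form k f t = 0) \<longleftrightarrow>
            (\<forall>S. S \<subseteq> {1..n} \<and> \<not> even_set S \<longrightarrow> flag_L k n f S = 0))"
proof -
  \<comment> \<open>The integer \<open>2 * k\<close> becomes the number \<open>m\<close> of copies
    of a rank in the test posets.\<close>
  obtain m :: nat where m: "2 * k = real m"
    using assms(1) by (auto elim: Nats_cases)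
  have k: "k \<noteq> 0" "k = real m / 2" "0 < m"
    using assms(2) m by auto
  have "(\<lambda>f. \<Sum>S\<in>Pow {1..n}. c S * f S) \<in> relation_span k n"
    if c: "\<forall>(r :: nat rel) \<rho>. k_eulerian k r \<rho> (n + 1) \<longrightarrow>
      (\<Sum>S\<in>Pow {1..n}. c S * real (flag_f r \<rho> S)) = 0" for c
  proof -
    \<comment> \<open>In \<open>L\<close>-coordinates the form splits by \<open>R\<close>: at even
      \<open>R\<close> the test posets make the coefficient zero, and at every other
      \<open>R\<close> the \<open>L\<close>-value itself lies in the span.\<close>
    have "(\<lambda>f. (\<Sum>U\<in>Pow ({1..n} - R). c U * (2 * k) ^ card U) * flag_L k n f R) \<in> relation_span k n"
      if R: "R \<in> Pow {1..n}" for R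
    proof (cases "even_set R")
      case True
      have "(\<Sum>U\<in>Pow ({1..n} - R). c U * (2 * k) ^ card U) = 0"
        unfolding m by (rule even_coefficient_eq_0[OF k(3)]) (use c R True k(2) in auto)
      \<comment> \<open>The zero form is obtained as a sum over the empty family.\<close>
      then show ?thesis
        using relation_span_sum[of "{}" _ k n] by simp
    next
      case False
      then show ?thesis
        using R by (intro relation_span_scale flag_L_in_relation_span k(1)) auto
    qed
    then have "(\<lambda>f. \<Sum>R\<in>Pow {1..n}. (\<Sum>U\<in>Pow ({1..n} - R). c U * (2 * k) ^ card U) * flag_L k n f R)
        \<in> relation_span k n"
      by (rule relation_span_sum)
    moreover have "(\<lambda>f. \<Sum>S\<in>Pow {1..n}. c S * f S)
        = (\<lambda>f. \<Sum>R\<in>Pow {1..n}. (\<Sum>U\<in>Pow ({1..n} - R). c U * (2 * k) ^ card U) * flag_L k n f R)"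
      by (rule ext, rule linear_form_flag_L[OF k(1)])
    ultimately show ?thesis
      by (simp only:)
  qed
  then have 2: "\<forall>c :: nat set \<Rightarrow> real.
      (\<forall>(r :: nat rel) \<rho>. k_eulerian k r \<rho> (n + 1) \<longrightarrow>
         (\<Sum>S\<in>Pow {1..n}. c S * real (flag_f r \<rho> S)) = 0) \<longrightarrow>
      (\<exists>a :: nat set \<times> nat \<times> nat \<Rightarrow> real. \<forall>f :: nat set \<Rightarrow> real.
         (\<Sum>S\<in>Pow {1..n}. c S * f S) = (\<Sum>t\<in>relation_index n. a t * relation_form k f t))"
    unfolding relation_span_def by blast
  \<comment> \<open>From left to right, each \<open>L\<close>-value at a set that is not even is a
    combination of relations and vanishes with them.\<close>
  have 3: "(\<forall>t\<in>relation_index n. relation_form k f t = 0) \<longleftrightarrow>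
      (\<forall>S. S \<subseteq> {1..n} \<and> \<not> even_set S \<longrightarrow> flag_L k n f S = 0)" for f
    using relation_form_eq_0[OF k(1)] relation_span_eq_0[OF flag_L_in_relation_span[OF k(1)]] by blast
  show ?thesis
    using k_eulerian_relation_form[OF k(1)] 2 3 by blast
qed

end
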